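(* In the presence of honest-but-curious or eavesdropping adversaries, algorithm PDG-NDS protects the privacy of all participating agents. That is, for every agent $i$, every finite number of iterations $T$, every collection of (nonzero) gradient values $g_i^1,\dots,g_i^T$ of agent $i$ arising in a run of PDG-NDS, and all real numbers $\zeta^1,\dots,\zeta^T$ (arbitrarily large, possibly different for different $k$), there exist alternative gradient values $\hat g_i^1,\dots,\hat g_i^T\in\mathbb{R}^d$ with $$\log\frac{\|\hat g_i^k\|}{\|g_i^k\|}=\zeta^k,\qquad k=1,\dots,T,$$ and an alternative admissible realization of agent $i$'s private parameters, such that the information $\mathcal{I}_i$ shared by agent $i$ is identical to the information it shares in the original run.
   Context: Setting: $m$ agents interact on an undirected graph with nonnegative weight matrix $W=\{w_{ij}\}\in\mathbb{R}^{m\times m}$, with $w_{ij}>0$ iff agents $i,j$ can interact, $w_{ii}>0$, $\mathbb{N}_i=\{j:w_{ij}>0\}$, $W\mathbf{1}=\mathbf{1}$, $\mathbf{1}^TW=\mathbf{1}^T$, $\|W-\frac{\mathbf{1}\mathbf{1}^T}{m}\|<1$. Agent $i$ has a private objective $f_i:\mathbb{R}^d\to\mathbb{R}$, and $g_i^k$ denotes the gradient of $f_i$ at $x_i^k$. Algorithm PDG-NDS: at iteration $k=1$, agent $i$ shares its randomly selected $x_i^0$ with its neighbors and sets $x_i^1=\sum_{j\in\mathbb{N}_i}w_{ij}x_j^0-\lambda_i^0\nabla f_i(x_i^0)$. At iterations $k=2,3,\dots$, every agent $j$ sends to each $i\in\mathbb{N}_j$ the message $$v_{ij}^k=2w_{ij}x_j^{k-1}-\{W^2\}_{ij}x_j^{k-2}-b_{ij}^{k-2}\left(\lambda_j^{k-1}g_j^{k-1}-\lambda_j^{k-2}g_j^{k-2}\right),$$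 where $\{W^2\}_{ij}$ is the $(i,j)$ entry of $W^2$, and agent $i$ sets $x_i^k=\sum_{j\in\mathbb{N}_i}v_{ij}^k$. The matrix $W$ is public. The private parameters of agent $i$ are $x_i^0$ (not known to parties other than those with which it is shared), the stepsizes $\lambda_i^k$, and the coefficients $b_{ji}^k$, $j\in\mathbb{N}_i$. They are admissible if $\lambda_i^k\ge0$, $b_{ji}^k\ge0$ and $\sum_{j\in\mathbb{N}_i}b_{ji}^k=1$ for all $k$. Adversaries: honest-but-curious adversaries are participating agents (colluding or not) that follow the protocol but collect all received data to learn about other agents; eavesdropping adversaries are external parties that wiretap all communication channels. In either case the information obtained from agent $i$ is contained in the information it shares, $\mathcal{I}_i=\mathcal{I}_i^{\rm sent}\cup\mathcal{I}_i^{\rm public}$, where $\mathcal{I}_i^{\rm sent}$ consists of all messages sent by agent $i$ (the initial $x_i^0$ and all $v_{ji}^k$, $j\in\mathbb{N}_i$) and $\mathcal{I}_i^{\rm public}$ consists of $W$ and the relations $\sum_{j\in\mathbb{N}_i}b_{ji}^k=1$, $k=0,1,\dots$. Privacy definition: the difference from $x$ to $x'$ is $\zeta=\log\frac{\|x\|}{\|x'\|}$ (positive or negative). The privacy of agent $i$ is preserved if for any finite number of iterations $T$, its gradient values $g_i^1,\dots,g_i^T$ always have alternative realizations $\hat g_i^1,\dots,\hat g_i^T$ which allow each $\hat g_i^k$ ($1\le k\le T$) to have an arbitrarily large difference from $g_i^k$ (possibly different for different $k$), but lead to the same shared information in inter-agent communications. Gradient values are regarded as the vectors $g_i^k$ entering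 the messages; gradient values at iterations other than $1,\dots,T$ are unchanged. *)

theory Defs
  imports "HOL-Analysis.Analysis"
begin

text \<open>
  Agents are the elements of a finite type \<open>'m\<close>; \<open>W $ i $ j\<close> is the weight \<open>w\<^sub>i\<^sub>j\<close>.
\<close>

definition neighbors :: "real^'m^'m \<Rightarrow> 'm \<Rightarrow> 'm set" where
  "neighbors W i = {j. 0 < W $ i $ j}"

text \<open>
  Symmetry of the positivity pattern expresses that the interaction graph is undirected; the
  weights themselves need not be symmetric. The matrix norm is the one induced by the Euclidean
  norm, hence \<open>onorm\<close>: \<open>norm\<close> on type \<open>real^'m^'m\<close> is the Frobenius norm.
\<close>

definition weight_matrix :: "real^'m^'m \<Rightarrow> bool" where
  "weight_matrix W \<longleftrightarrow>
     (\<forall>i j. 0 \<le> W $ i $ j) \<and>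
     (\<forall>i j. 0 < W $ i $ j \<longleftrightarrow> 0 < W $ j $ i) \<and>
     (\<forall>i. 0 < W $ i $ i) \<and>
     W *v 1 = 1 \<and> 1 v* W = 1 \<and>
     onorm (\<lambda>x. (W - (\<chi> i j. 1 / real CARD('m))) *v x) < 1"

text \<open>
  The private parameters of one agent \<open>i\<close>: \<open>x\<^sub>i\<^sup>0\<close>, the stepsizes \<open>\<lambda>\<^sub>i\<^sup>k\<close>, and the coefficients
  \<open>b\<^sub>j\<^sub>i\<^sup>k = coeff p k j\<close>, where \<open>j\<close> is the recipient.
\<close>

record ('m, 'd::finite) private_params =
  init :: "real^'d"
  stepsize :: "nat \<Rightarrow> real"
  coeff :: "nat \<Rightarrow> 'm \<Rightarrow> real"

definition admissible :: "real^'m^'m \<Rightarrow> 'm \<Rightarrow> ('m, 'd::finite) private_params \<Rightarrow> bool" where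
  "admissible W i p \<longleftrightarrow>
     (\<forall>k. 0 \<le> stepsize p k) \<and>
     (\<forall>k. \<forall>j\<in>neighbors W i. 0 \<le> coeff p k j) \<and>
     (\<forall>k. (\<Sum>j\<in>neighbors W i. coeff p k j) = 1)"

text \<open>
  The algorithm, driven by the parameters \<open>P j\<close> of all agents and by the vectors \<open>g j k\<close> used as
  gradient values. \<open>state W P g k i\<close> is \<open>x\<^sub>i\<^sup>k\<close>, and \<open>message W P g k i j\<close> is \<open>v\<^sub>i\<^sub>j\<^sup>k\<close>, the message
  sent from \<open>j\<close> to \<open>i\<close>. Messages exist only for iterations \<open>k \<ge> 2\<close> and are unspecified otherwise.
\<close>

fun state :: "real^'m^'m \<Rightarrow> ('m \<Rightarrow> ('m, 'd::finite) private_params) \<Rightarrow>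
    ('m \<Rightarrow> nat \<Rightarrow> real^'d) \<Rightarrow> nat \<Rightarrow> 'm \<Rightarrow> real^'d"
  and message :: "real^'m^'m \<Rightarrow> ('m \<Rightarrow> ('m, 'd) private_params) \<Rightarrow>
    ('m \<Rightarrow> nat \<Rightarrow> real^'d) \<Rightarrow> nat \<Rightarrow> 'm \<Rightarrow> 'm \<Rightarrow> real^'d" where
  "state W P g 0 i = init (P i)"
| "state W P g (Suc 0) i =
     (\<Sum>j\<in>neighbors W i. (W $ i $ j) *\<^sub>R init (P j)) - stepsize (P i) 0 *\<^sub>R g i 0"
| "state W P g (Suc (Suc k)) i = (\<Sum>j\<in>neighbors W i. message W P g (Suc (Suc k)) i j)"
| "message W P g (Suc (Suc k)) i j =
     (2 * W $ i $ j) *\<^sub>R state W P g (Suc k) j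
     - ((W ** W) $ i $ j) *\<^sub>R state W P g k j
     - coeff (P j) k i *\<^sub>R
         (stepsize (P j) (Suc k) *\<^sub>R g j (Suc k) - stepsize (P j) k *\<^sub>R g j k)"

text \<open>
  Pieces of information an agent shares: its initial state, the message of iteration \<open>k\<close> together
  with its recipient, the matrix \<open>W\<close>, and, as \<open>Coeff_Sum k s\<close>, the relation that its coefficients
  of index \<open>k\<close> sum to \<open>s\<close> (where \<open>s = 1\<close> for admissible parameters).
\<close>

datatype ('m::finite, 'd::finite) info =
    Init_State "real^'d"
  | Message nat 'm "real^'d"
  | Weights "real^'m^'m"
  | Coeff_Sum nat real

definition sent_info :: "real^'m^'m \<Rightarrow> ('m \<Rightarrow> ('m, 'd::finite) private_params) \<Rightarrow>
    ('m \<Rightarrow> nat \<Rightarrow> real^'d) \<Rightarrow> 'm \<Rightarrow> ('m, 'd) info set" where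
  "sent_info W P g i =
     {Init_State (init (P i))} \<union>
     {Message k j (message W P g k j i) |k j. 2 \<le> k \<and> j \<in> neighbors W i}"

definition public_info :: "real^'m^'m \<Rightarrow> ('m \<Rightarrow> ('m, 'd::finite) private_params) \<Rightarrow>
    'm \<Rightarrow> ('m, 'd) info set" where
  "public_info W P i =
     {Weights W} \<union> {Coeff_Sum k (\<Sum>j\<in>neighbors W i. coeff (P i) k j) |k. True}"

definition shared_info :: "real^'m^'m \<Rightarrow> ('m \<Rightarrow> ('m, 'd::finite) private_params) \<Rightarrow>
    ('m \<Rightarrow> nat \<Rightarrow> real^'d) \<Rightarrow> 'm \<Rightarrow> ('m, 'd) info set" where
  "shared_info W P g i = sent_info W P g i \<union> public_info W P i"

end

theory Submission
  imports Defs
begin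

text \<open>
  A gradient never enters the algorithm alone, but only multiplied by the stepsize of the same
  agent and iteration, and stepsizes are private, constrained only to be nonnegative. Hence a
  gradient can be scaled by any factor \<open>c > 0\<close> while its stepsize is divided by \<open>c\<close>: every
  increment \<open>\<lambda>\<^sub>i\<^sup>k g\<^sub>i\<^sup>k\<close>, and with it the whole run of all agents, stays the same
  (\<open>run_determined_by_increments\<close>). The factor \<open>c = exp \<zeta>\<close> realizes the logarithmic difference
  \<open>\<zeta>\<close>. Initial states and coefficients are kept, so all shared information is the same.
\<close>

text \<open>
  Both equations are proved together because the two functions call each other: a state from
  iteration 2 on is a sum of messages of the same iteration, whereas a message uses the two
  preceding states.
\<close>

lemma run_determined_by_increments:
  fixes W :: "real^'m^'m" and P Q :: "'m \<Rightarrow> ('m, 'd::finite) private_params"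
  assumes init: "\<And>j. init (P j) = init (Q j)"
    and coeff: "\<And>j. coeff (P j) = coeff (Q j)"
    and increment: "\<And>j k. stepsize (P j) k *\<^sub>R g j k = stepsize (Q j) k *\<^sub>R h j k"
  shows "state W P g k j = state W Q h k j"
    and "2 \<le> k \<Longrightarrow> message W P g k j l = message W Q h k j l"
proof -
  have "(\<forall>j. state W P g k j = state W Q h k j) \<and>
        (2 \<le> k \<longrightarrow> (\<forall>j l. message W P g k j l = message W Q h k j l))"
  proof (induction k rule: less_induct)
    case (less k)
    consider "k = 0" | "k = Suc 0" | n where "k = Suc (Suc n)"
      by (metis not0_implies_Suc)
    then show ?case
    proof cases
      case 3
      have "state W P g n j = state W Q h n j"
        and "state W P g (Suc n) j = state W Q h (Suc n) j" for j
        using less 3 by simp_all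
      then show ?thesis
        using 3 by (simp add: coeff increment)
    qed (simp_all add: init increment)
  qed
  then show "state W P g k j = state W Q h k j"
    and "2 \<le> k \<Longrightarrow> message W P g k j l = message W Q h k j l"
    by blast+
qed

theorem theorem4:
  fixes W :: "real^'m^'m"
    and f :: "'m \<Rightarrow> real^'d \<Rightarrow> real"
    and P :: "'m \<Rightarrow> ('m, 'd) private_params"
    and g :: "'m \<Rightarrow> nat \<Rightarrow> real^'d"
    and i :: 'm and T :: nat and \<zeta> :: "nat \<Rightarrow> real"
  assumes "weight_matrix W"
    and "\<forall>j. admissible W j (P j)"
    and "\<forall>j k. GDERIV (f j) (state W P g k j) :> g j k"
    and "\<forall>k\<in>{1..T}. g i k \<noteq> 0"
  shows "\<exists>(\<gamma> :: nat \<Rightarrow> real^'d) p.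
           (\<forall>k\<in>{1..T}. \<gamma> k \<noteq> 0 \<and> ln (norm (\<gamma> k) / norm (g i k)) = \<zeta> k) \<and>
           (\<forall>k. k \<notin> {1..T} \<longrightarrow> \<gamma> k = g i k) \<and>
           admissible W i p \<and>
           shared_info W (P(i := p)) (g(i := \<gamma>)) i = shared_info W P g i"
proof -
  define c where "c k = (if k \<in> {1..T} then exp (\<zeta> k) else 1)" for k
  define \<gamma> where "\<gamma> k = c k *\<^sub>R g i k" for k
  define p where "p = (P i)\<lparr>stepsize := \<lambda>k. stepsize (P i) k / c k\<rparr>"
  have c_pos: "0 < c k" for k
    by (simp add: c_def)
  have same_init: "init ((P(i := p)) j) = init (P j)" for j
    by (simp add: p_def)
  have same_coeff: "coeff ((P(i := p)) j) = coeff (P j)" for j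
    by (simp add: p_def)
  have same_increment:
    "stepsize ((P(i := p)) j) k *\<^sub>R (g(i := \<gamma>)) j k = stepsize (P j) k *\<^sub>R g j k" for j k
    using c_pos[of k] by (simp add: p_def \<gamma>_def)
  have same_message:
    "message W (P(i := p)) (g(i := \<gamma>)) k j i = message W P g k j i" if "2 \<le> k" for k j
    by (rule run_determined_by_increments(2)[OF same_init same_coeff same_increment that])
  have "sent_info W (P(i := p)) (g(i := \<gamma>)) i = sent_info W P g i"
    unfolding sent_info_def same_init using same_message by (metis (no_types, lifting))
  moreover have "public_info W (P(i := p)) i = public_info W P i"
    unfolding public_info_def same_coeff ..
  ultimately have "shared_info W (P(i := p)) (g(i := \<gamma>)) i = shared_info W P g i"
    by (simp add: shared_info_def)
  moreover have "admissible W i p"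
    using assms(2) c_pos by (simp add: admissible_def p_def less_imp_le)
  moreover have "\<forall>k\<in>{1..T}. \<gamma> k \<noteq> 0 \<and> ln (norm (\<gamma> k) / norm (g i k)) = \<zeta> k"
    using assms(4) by (simp add: \<gamma>_def c_def)
  moreover have "\<forall>k. k \<notin> {1..T} \<longrightarrow> \<gamma> k = g i k"
    by (simp add: \<gamma>_def c_def)
  ultimately show ?thesis
    by blast
qed

end
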